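(* Consider the standard 2D-FFT OFDM radar processor with effective output SNR at orbital phase $\theta$, target range $R>0$ and radar cross section $\sigma>0$ given by $$\gamma(\theta,R,\sigma)=\frac{\mathrm{EIRP}\cdot G_r\,\lambda^2\,\sigma\,NM\,\mathcal{G}(v_{\mathrm{rel}}(\theta))}{(4\pi)^3R^4k_BT_{\mathrm{sys}}B},$$ assumed positive. Then the Cramér–Rao bounds (achievable by this processor) for range and velocity estimation at orbital phase $\theta$ are $$\mathrm{CRB}_R(\theta)=\frac{c^2}{32\pi^2\,\gamma(\theta,R,\sigma)\,\beta_{\mathrm{rms}}^2},\qquad \mathrm{CRB}_v(\theta)=\frac{c^2}{32\pi^2f_c^2\,\gamma(\theta,R,\sigma)\,\gamma_{\mathrm{rms}}^2}.$$ Both bounds depend on the orbital phase $\theta$ through the processing efficiency $\mathcal{G}(v_{\mathrm{rel}}(\theta))$.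
   Context: Constants and parameters (all positive): speed of light $c$, carrier frequency $f_c$, wavelength $\lambda$, effective isotropic radiated power $\mathrm{EIRP}$, receive gain $G_r$, Boltzmann constant $k_B$, system temperature $T_{\mathrm{sys}}$, number of subcarriers $N\ge2$, symbols per coherent processing interval $M\ge2$, subcarrier spacing $\Delta f$, bandwidth $B=N\Delta f$, symbol duration $T_{\mathrm{sym}}$. The function $v_{\mathrm{rel}}(\theta)$ is the target's relative radial velocity at orbital phase $\theta$. The processing efficiency is $$\mathcal{G}(v)=\mathrm{sinc}^2\!\left(\frac{2vf_c}{c\,\Delta f}\right)\eta_{\mathrm{impl}},\qquad \mathrm{sinc}(x)=\frac{\sin\pi x}{\pi x},\qquad \eta_{\mathrm{impl}}\in(0,1].$$ Also $\beta_{\mathrm{rms}}^2=\frac{N^2-1}{12}\Delta f^2$ and $\gamma_{\mathrm{rms}}^2=\frac{M^2-1}{12}T_{\mathrm{sym}}^2$. Delay $\tau$ and Doppler $f_d$ are related to range and velocity by $\tau=2R/c$ and $f_d=2vf_c/c$. The single-interval Fisher information matrix for $(\tau,f_d)$ is $2NM\gamma_{\mathrm{sc}}\,\mathrm{diag}(4\pi^2\beta_{\mathrm{rms}}^2,4\pi^2\gamma_{\mathrm{rms}}^2)$, where $\gamma_{\mathrm{sc}}$ is the per-subcarrier SNR. The processor-specific (achievable) bound is the one obtained by replacing the ideal integrated SNR $NM\gamma_{\mathrm{sc}}$ in this matrix by the effective output SNR $\gamma(\theta,R,\sigma)$. That is, $\mathrm{CRB}_R$ and $\mathrm{CRB}_v$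 are the diagonal entries of the inverse of $2\gamma\,\mathrm{diag}(4\pi^2\beta_{\mathrm{rms}}^2,4\pi^2\gamma_{\mathrm{rms}}^2)$ after the change of variables from $(\tau,f_d)$ to $(R,v)$. *)

theory Defs
  imports "HOL-Probability.Sinc_Integral"
begin

record ofdm_params =
  light_speed :: real
  carrier_freq :: real
  wavelength :: real
  eirp :: real
  rx_gain :: real
  boltzmann :: real
  sys_temp :: real
  num_subcarriers :: nat
  num_symbols :: nat
  subcarrier_spacing :: real
  symbol_duration :: real
  impl_efficiency :: real

definition valid_params :: "ofdm_params \<Rightarrow> bool" where
  "valid_params P \<longleftrightarrow>
     light_speed P > 0 \<and> carrier_freq P > 0 \<and> wavelength P > 0 \<and> eirp P > 0 \<and>
     rx_gain P > 0 \<and> boltzmann P > 0 \<and> sys_temp P > 0 \<and>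
     num_subcarriers P \<ge> 2 \<and> num_symbols P \<ge> 2 \<and>
     subcarrier_spacing P > 0 \<and> symbol_duration P > 0 \<and>
     0 < impl_efficiency P \<and> impl_efficiency P \<le> 1"

definition bandwidth :: "ofdm_params \<Rightarrow> real" where
  "bandwidth P = real (num_subcarriers P) * subcarrier_spacing P"

text \<open>The library's \<open>sinc\<close> is the unnormalised one (\<open>sin x / x\<close>, with value 1 at 0),
  hence the factor \<open>pi\<close>.\<close>

definition norm_sinc :: "real \<Rightarrow> real" where
  "norm_sinc x = sinc (pi * x)"

definition proc_efficiency :: "ofdm_params \<Rightarrow> real \<Rightarrow> real" where
  "proc_efficiency P v =
     (norm_sinc (2 * v * carrier_freq P / (light_speed P * subcarrier_spacing P)))\<^sup>2 * impl_efficiency P"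

definition beta_rms_sq :: "ofdm_params \<Rightarrow> real" where
  "beta_rms_sq P = ((real (num_subcarriers P))\<^sup>2 - 1) / 12 * (subcarrier_spacing P)\<^sup>2"

definition gamma_rms_sq :: "ofdm_params \<Rightarrow> real" where
  "gamma_rms_sq P = ((real (num_symbols P))\<^sup>2 - 1) / 12 * (symbol_duration P)\<^sup>2"

text \<open>Effective output SNR at orbital phase \<open>\<theta>\<close>, range \<open>R\<close> and radar cross section \<open>\<sigma>\<close>.\<close>

definition output_snr ::
  "ofdm_params \<Rightarrow> (real \<Rightarrow> real) \<Rightarrow> real \<Rightarrow> real \<Rightarrow> real \<Rightarrow> real" where
  "output_snr P v_rel \<theta> R \<sigma> =
     (eirp P * rx_gain P * (wavelength P)\<^sup>2 * \<sigma> *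
        real (num_subcarriers P) * real (num_symbols P) * proc_efficiency P (v_rel \<theta>)) /
     ((4 * pi) ^ 3 * R ^ 4 * boltzmann P * sys_temp P * bandwidth P)"

text \<open>Fisher information matrix for (delay, Doppler) as a function of the integrated SNR \<open>s\<close>.
  The ideal single-interval matrix has \<open>s = N * M * \<gamma>\<^sub>s\<^sub>c\<close>, with \<open>\<gamma>\<^sub>s\<^sub>c\<close> the per-subcarrier SNR;
  the processor-specific matrix has the effective output SNR in its place.\<close>

definition fisher_delay_doppler :: "ofdm_params \<Rightarrow> real \<Rightarrow> real^2^2" where
  "fisher_delay_doppler P s =
     (2 * s) *\<^sub>R vector [vector [4 * pi\<^sup>2 * beta_rms_sq P, 0],
                       vector [0, 4 * pi\<^sup>2 * gamma_rms_sq P]]"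

definition delay_doppler :: "ofdm_params \<Rightarrow> real^2 \<Rightarrow> real^2" where
  "delay_doppler P x =
     vector [2 * x $ 1 / light_speed P, 2 * x $ 2 * carrier_freq P / light_speed P]"

text \<open>Reparametrisation rule \<open>J\<^sup>T I J\<close> for Fisher information, with \<open>J\<close> the Jacobian of
  (range, velocity) \<open>\<mapsto>\<close> (delay, Doppler) at the true parameter \<open>x\<close>.\<close>

definition fisher_range_velocity :: "ofdm_params \<Rightarrow> real \<Rightarrow> real^2 \<Rightarrow> real^2^2" where
  "fisher_range_velocity P s x =
     (let J = jacobian (delay_doppler P) (at x)
      in transpose J ** fisher_delay_doppler P s ** J)"

definition crb_matrix ::
  "ofdm_params \<Rightarrow> (real \<Rightarrow> real) \<Rightarrow> real \<Rightarrow> real \<Rightarrow> real \<Rightarrow> real^2^2" where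
  "crb_matrix P v_rel \<theta> R \<sigma> =
     matrix_inv (fisher_range_velocity P (output_snr P v_rel \<theta> R \<sigma>) (vector [R, v_rel \<theta>]))"

definition CRB_R ::
  "ofdm_params \<Rightarrow> (real \<Rightarrow> real) \<Rightarrow> real \<Rightarrow> real \<Rightarrow> real \<Rightarrow> real" where
  "CRB_R P v_rel \<theta> R \<sigma> = crb_matrix P v_rel \<theta> R \<sigma> $ 1 $ 1"

definition CRB_v ::
  "ofdm_params \<Rightarrow> (real \<Rightarrow> real) \<Rightarrow> real \<Rightarrow> real \<Rightarrow> real \<Rightarrow> real" where
  "CRB_v P v_rel \<theta> R \<sigma> = crb_matrix P v_rel \<theta> R \<sigma> $ 2 $ 2"

end

theory Submission
  imports Defs
begin

text \<open>Delay depends on range alone and Doppler on velocity alone, both linearly, so the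
  Jacobian is a constant diagonal matrix. The Fisher matrix in (range, velocity) is then diagonal
  too (\<open>fisher_range_velocity_eq\<close>), and inverting its entries gives both bounds
  (\<open>CRB_R_eq\<close>, \<open>CRB_v_eq\<close>). For the dependence on the phase,
  \<open>output_snr_proportional\<close> writes the SNR as a positive constant times the processing
  efficiency. Each bound thus has the form a / (b * g) in the efficiency g. This function is
  injective, so phases with different positive efficiencies have different bounds.\<close>

lemma matrix_inv_unique:
  fixes A B :: "'a::semiring_1^'n^'n"
  assumes "A ** B = mat 1" and "B ** A = mat 1"
  shows "matrix_inv A = B"
proof (unfold matrix_inv_def, rule some_equality)
  show "A ** B = mat 1 \<and> B ** A = mat 1"
    using assms by simp
  \<comment> \<open>\<open>matrix_inv\<close> is a choice among two-sided inverses, and C = C (A B)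
    = (C A) B = B leaves only one candidate.\<close>
  show "C = B" if "A ** C = mat 1 \<and> C ** A = mat 1" for C
    by (metis assms(1) that matrix_mul_assoc matrix_mul_lid matrix_mul_rid)
qed

lemma matrix_inv_diag_2:
  fixes a b :: real
  assumes "a \<noteq> 0" and "b \<noteq> 0"
  shows "matrix_inv (vector [vector [a, 0], vector [0, b]] :: real^2^2) =
           vector [vector [1 / a, 0], vector [0, 1 / b]]"
  by (rule matrix_inv_unique)
     (use assms in \<open>simp_all add: vec_eq_iff forall_2 matrix_matrix_mult_def sum_2 mat_def\<close>)

lemma linear_delay_doppler: "linear (delay_doppler P)"
  by (rule linearI)
     (simp_all add: delay_doppler_def vec_eq_iff forall_2 algebra_simps add_divide_distrib)

text \<open>A linear map is its own Frechet derivative, so the Jacobian is the matrix of the map,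
  the same at every \<open>x\<close>.\<close>

lemma jacobian_delay_doppler:
  "jacobian (delay_doppler P) (at x) =
     vector [vector [2 / light_speed P, 0],
             vector [0, 2 * carrier_freq P / light_speed P]]"
proof -
  have "frechet_derivative (delay_doppler P) (at x) = delay_doppler P"
    by (metis frechet_derivative_at linear_delay_doppler linear_imp_has_derivative)
  then show ?thesis
    by (simp add: jacobian_def matrix_def delay_doppler_def vec_eq_iff forall_2 axis_def)
qed

text \<open>The constant 32 is 2 * 4 from the delay-Doppler matrix times the square of the 2 in each
  Jacobian entry; the Doppler entry also contributes the squared carrier frequency.\<close>

lemma fisher_range_velocity_eq:
  "fisher_range_velocity P s x =
     vector [vector [32 * pi\<^sup>2 * s * beta_rms_sq P / (light_speed P)\<^sup>2, 0],
             vector [0, 32 * pi\<^sup>2 * (carrier_freq P)\<^sup>2 * s * gamma_rms_sq P / (light_speed P)\<^sup>2]]"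
  unfolding fisher_range_velocity_def jacobian_delay_doppler Let_def fisher_delay_doppler_def
  by (simp add: vec_eq_iff forall_2 matrix_matrix_mult_def transpose_def sum_2 power2_eq_square)

text \<open>At least two subcarriers give N^2 > 1; a single one would make the range entry of the
  Fisher matrix vanish.\<close>

lemma beta_rms_sq_pos: "valid_params P \<Longrightarrow> beta_rms_sq P > 0"
  unfolding beta_rms_sq_def valid_params_def by (simp add: one_less_power)

lemma gamma_rms_sq_pos: "valid_params P \<Longrightarrow> gamma_rms_sq P > 0"
  unfolding gamma_rms_sq_def valid_params_def by (simp add: one_less_power)

lemma
  assumes P: "valid_params P" and snr: "output_snr P v_rel \<theta> R \<sigma> > 0"
  shows CRB_R_eq: "CRB_R P v_rel \<theta> R \<sigma> =
      (light_speed P)\<^sup>2 / (32 * pi\<^sup>2 * output_snr P v_rel \<theta> R \<sigma> * beta_rms_sq P)"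
    and CRB_v_eq: "CRB_v P v_rel \<theta> R \<sigma> =
      (light_speed P)\<^sup>2 /
        (32 * pi\<^sup>2 * (carrier_freq P)\<^sup>2 * output_snr P v_rel \<theta> R \<sigma> * gamma_rms_sq P)"
proof -
  have "light_speed P \<noteq> 0" "carrier_freq P \<noteq> 0"
    using P by (auto simp: valid_params_def)
  then have "crb_matrix P v_rel \<theta> R \<sigma> =
      vector [vector [(light_speed P)\<^sup>2 /
                (32 * pi\<^sup>2 * output_snr P v_rel \<theta> R \<sigma> * beta_rms_sq P), 0],
              vector [0, (light_speed P)\<^sup>2 /
                (32 * pi\<^sup>2 * (carrier_freq P)\<^sup>2 * output_snr P v_rel \<theta> R \<sigma> * gamma_rms_sq P)]]"
    \<comment> \<open>Positive SNR and positive mean-square widths make both diagonal entries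
      nonzero, as the inversion requires.\<close>
    using snr beta_rms_sq_pos[OF P] gamma_rms_sq_pos[OF P]
    unfolding crb_matrix_def fisher_range_velocity_eq by (subst matrix_inv_diag_2) simp_all
  then show "CRB_R P v_rel \<theta> R \<sigma> =
      (light_speed P)\<^sup>2 / (32 * pi\<^sup>2 * output_snr P v_rel \<theta> R \<sigma> * beta_rms_sq P)"
    and "CRB_v P v_rel \<theta> R \<sigma> =
      (light_speed P)\<^sup>2 /
        (32 * pi\<^sup>2 * (carrier_freq P)\<^sup>2 * output_snr P v_rel \<theta> R \<sigma> * gamma_rms_sq P)"
    by (simp_all add: CRB_R_def CRB_v_def)
qed

text \<open>Only the efficiency factor of the SNR involves the phase; \<open>K\<close> collects all
  the others, so one \<open>K\<close> serves every phase.\<close>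

lemma output_snr_proportional:
  assumes "valid_params P" and "R > 0" and "\<sigma> > 0"
  obtains K where "K > 0" and "\<And>\<theta>. output_snr P v_rel \<theta> R \<sigma> = K * proc_efficiency P (v_rel \<theta>)"
proof
  let ?K = "(eirp P * rx_gain P * (wavelength P)\<^sup>2 * \<sigma> * real (num_subcarriers P) *
      real (num_symbols P)) /
    ((4 * pi) ^ 3 * R ^ 4 * boltzmann P * sys_temp P * bandwidth P)"
  show "?K > 0"
    using assms unfolding valid_params_def bandwidth_def
    by (intro divide_pos_pos mult_pos_pos zero_less_power) auto
  show "output_snr P v_rel \<theta> R \<sigma> = ?K * proc_efficiency P (v_rel \<theta>)" for \<theta>
    by (simp add: output_snr_def)
qed

text \<open>\<open>S\<close> may even contain 0: since \<open>inverse 0 = 0\<close>, inversion is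
  injective on the whole field.\<close>

lemma inj_on_divide_mult:
  fixes a b :: "'a::field"
  assumes "a \<noteq> 0" and "b \<noteq> 0"
  shows "inj_on (\<lambda>x. a / (b * x)) S"
  using assms by (auto simp: inj_on_def divide_inverse)

theorem theorem2:
  fixes P :: ofdm_params and v_rel :: "real \<Rightarrow> real" and R \<sigma> :: real
  assumes "valid_params P" and "R > 0" and "\<sigma> > 0"
  shows "(\<forall>\<theta>. output_snr P v_rel \<theta> R \<sigma> > 0 \<longrightarrow>
            CRB_R P v_rel \<theta> R \<sigma> =
              (light_speed P)\<^sup>2 / (32 * pi\<^sup>2 * output_snr P v_rel \<theta> R \<sigma> * beta_rms_sq P) \<and>
            CRB_v P v_rel \<theta> R \<sigma> =
              (light_speed P)\<^sup>2 /
                (32 * pi\<^sup>2 * (carrier_freq P)\<^sup>2 * output_snr P v_rel \<theta> R \<sigma> * gamma_rms_sq P)) \<and>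
         (\<exists>h_R h_v :: real \<Rightarrow> real. inj_on h_R {0<..} \<and> inj_on h_v {0<..} \<and>
            (\<forall>\<theta>. output_snr P v_rel \<theta> R \<sigma> > 0 \<longrightarrow>
               CRB_R P v_rel \<theta> R \<sigma> = h_R (proc_efficiency P (v_rel \<theta>)) \<and>
               CRB_v P v_rel \<theta> R \<sigma> = h_v (proc_efficiency P (v_rel \<theta>))))"
proof (intro conjI allI impI)
  fix \<theta> assume "output_snr P v_rel \<theta> R \<sigma> > 0"
  then show "CRB_R P v_rel \<theta> R \<sigma> =
      (light_speed P)\<^sup>2 / (32 * pi\<^sup>2 * output_snr P v_rel \<theta> R \<sigma> * beta_rms_sq P)"
    and "CRB_v P v_rel \<theta> R \<sigma> =
      (light_speed P)\<^sup>2 /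
        (32 * pi\<^sup>2 * (carrier_freq P)\<^sup>2 * output_snr P v_rel \<theta> R \<sigma> * gamma_rms_sq P)"
    using assms by (simp_all add: CRB_R_eq CRB_v_eq)
next
  obtain K where K: "K > 0"
    and snr: "\<And>\<theta>. output_snr P v_rel \<theta> R \<sigma> = K * proc_efficiency P (v_rel \<theta>)"
    using output_snr_proportional[OF assms, of v_rel] by blast
  \<comment> \<open>The closed forms with the SNR replaced by \<open>K * g\<close>. They do not
    mention the phase, and since \<open>K > 0\<close> the SNR is positive exactly when the
    efficiency lies in \<open>{0<..}\<close>.\<close>
  define h_R where "h_R = (\<lambda>g. (light_speed P)\<^sup>2 / (32 * pi\<^sup>2 * K * beta_rms_sq P * g))"
  define h_v where
    "h_v = (\<lambda>g. (light_speed P)\<^sup>2 / (32 * pi\<^sup>2 * (carrier_freq P)\<^sup>2 * K * gamma_rms_sq P * g))"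
  have "light_speed P \<noteq> 0" "carrier_freq P \<noteq> 0"
    using assms(1) by (auto simp: valid_params_def)
  then have "inj_on h_R {0<..}" "inj_on h_v {0<..}"
    using K beta_rms_sq_pos[OF assms(1)] gamma_rms_sq_pos[OF assms(1)]
    unfolding h_R_def h_v_def by (simp_all add: inj_on_divide_mult)
  moreover have "CRB_R P v_rel \<theta> R \<sigma> = h_R (proc_efficiency P (v_rel \<theta>)) \<and>
      CRB_v P v_rel \<theta> R \<sigma> = h_v (proc_efficiency P (v_rel \<theta>))"
    if "output_snr P v_rel \<theta> R \<sigma> > 0" for \<theta>
    using CRB_R_eq[OF assms(1) that] CRB_v_eq[OF assms(1) that]
    by (simp add: snr h_R_def h_v_def mult_ac)
  ultimately show "\<exists>h_R h_v :: real \<Rightarrow> real. inj_on h_R {0<..} \<and> inj_on h_v {0<..} \<and>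
      (\<forall>\<theta>. output_snr P v_rel \<theta> R \<sigma> > 0 \<longrightarrow>
         CRB_R P v_rel \<theta> R \<sigma> = h_R (proc_efficiency P (v_rel \<theta>)) \<and>
         CRB_v P v_rel \<theta> R \<sigma> = h_v (proc_efficiency P (v_rel \<theta>)))"
    by blast
qed

end
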